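(* Let $\mathcal{X}\subseteq\{0,1\}^n$ be a non-empty downward closed set family, let $\mu$ be a distribution fully supported on $\mathcal{X}$, and let $\delta\in[0,1]$. If for each non-maximal $S\in\mathcal{X}$, $$M_S\preceq I+(1-\delta)\,\mathrm{diag}(\mathbf{r}_S)^{-1},$$ then for every non-maximal $S\in\mathcal{X}$ and every $\theta\in(0,1)$, $$\mathrm{Cov}\left((1-\theta)*\mu^S\right)\preceq\frac{1}{1-(1-\delta)(1-\theta)}\,\mathrm{diag}\left(\mathbf{m}\left((1-\theta)*\mu^S\right)\right).$$
   Context: Elements of $\{0,1\}^n$ are identified with subsets of $[n]$. $\mathcal{X}$ is downward closed if $T\in\mathcal{X}$, $S\subseteq T$ imply $S\in\mathcal{X}$; $\mu$ is fully supported on $\mathcal{X}$ if $\mu(S)>0$ exactly for $S\in\mathcal{X}$. For $S\in\mathcal{X}$, $V_S=\{i\in[n]\setminus S: S\cup\{i\}\in\mathcal{X}\}$; $S$ is maximal if $V_S=\emptyset$. $\mu^S$ is the distribution on subsets $T\subseteq[n]\setminus S$ with $S\cup T\in\mathcal{X}$, $\mu^S(T)\propto\mu(S\cup T)$. For non-maximal $S$, $\mathbf{r}_S(i)=\mu(S\cup\{i\})/\mu(S)$ for $i\in V_S$, and $M_S\in\mathbb{R}^{V_S\times V_S}$ has zero diagonal and $M_S(i,j)=\frac{\mu^S(\{i,j\})\mu^S(\emptyset)}{\mu^S(\{i\})\mu^S(\{j\})}-1$ for $i\ne j$. For a distribution $\nu$ on subsets of a ground set $U$ and $\lambda>0$,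 $\lambda*\nu$ is the distribution with $(\lambda*\nu)(T)\propto\nu(T)\lambda^{|T|}$; $\mathbf{m}(\nu)=\mathbb{E}_{T\sim\nu}[\mathbf{1}_T]\in\mathbb{R}^U$ is its mean vector and $\mathrm{Cov}(\nu)=\mathbb{E}_{T\sim\nu}[(\mathbf{1}_T-\mathbf{m}(\nu))(\mathbf{1}_T-\mathbf{m}(\nu))^\intercal]$ its covariance matrix, with $\mathbf{1}_T$ the indicator vector. $\preceq$ is the Loewner order. *)

theory Defs
  imports "HOL-Probability.Probability"
begin

text \<open>
  Elements of $\{0,1\}^n$ are subsets of a finite ground set \<open>G\<close>, which is $\{1,\dots,n\}$ in the
  theorem. In the usual notation \<open>extensions G X S\<close> is $V_S$, \<open>link_pmf G X \<mu> S\<close> is $\mu^S$,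
  \<open>tilt_pmf U l \<nu>\<close> is $l * \nu$ for \<open>\<nu>\<close> on subsets of \<open>U\<close>, \<open>ratio_vec \<mu> S\<close> is $\mathbf{r}_S$, and
  \<open>corr_mat G X \<mu> S\<close> is $M_S$ (the last two are only meaningful at indices in $V_S$).
\<close>

definition downward_closed :: "'a set set \<Rightarrow> bool" where
  "downward_closed X \<longleftrightarrow> (\<forall>T\<in>X. \<forall>S. S \<subseteq> T \<longrightarrow> S \<in> X)"

definition fully_supported_on :: "'a set pmf \<Rightarrow> 'a set set \<Rightarrow> bool" where
  "fully_supported_on \<mu> X \<longleftrightarrow> (\<forall>S. pmf \<mu> S > 0 \<longleftrightarrow> S \<in> X)"

text \<open>
  The distribution on the finite set \<open>A\<close> whose mass function is proportional to \<open>w\<close>. It is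
  meaningful if \<open>w\<close> is nonnegative on \<open>A\<close> with positive total weight.
\<close>

definition proportional_pmf :: "'b set \<Rightarrow> ('b \<Rightarrow> real) \<Rightarrow> 'b pmf" where
  "proportional_pmf A w = embed_pmf (\<lambda>x. if x \<in> A then w x / (\<Sum>y\<in>A. w y) else 0)"

lemma pmf_proportional_pmf:
  assumes "finite A" "\<And>x. x \<in> A \<Longrightarrow> w x \<ge> 0" "(\<Sum>y\<in>A. w y) > 0"
  shows "pmf (proportional_pmf A w) x = (if x \<in> A then w x / (\<Sum>y\<in>A. w y) else 0)"
  unfolding proportional_pmf_def
proof (rule pmf_embed_pmf)
  let ?f = "\<lambda>x. if x \<in> A then w x / (\<Sum>y\<in>A. w y) else 0"
  show nn: "0 \<le> ?f x" for x
    using assms by (auto intro: divide_nonneg_pos)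
  have "(\<integral>\<^sup>+x. ennreal (?f x) \<partial>count_space UNIV) = (\<Sum>x\<in>A. ennreal (?f x))"
    by (rule nn_integral_count_space'[OF assms(1)]) auto
  also have "\<dots> = ennreal (\<Sum>x\<in>A. ?f x)"
    by (rule sum_ennreal) (use nn in blast)
  also have "(\<Sum>x\<in>A. ?f x) = 1"
    using assms(3) by (simp add: sum_divide_distrib[symmetric])
  finally show "(\<integral>\<^sup>+x. ennreal (?f x) \<partial>count_space UNIV) = 1" by simp
qed

definition extensions :: "'a set \<Rightarrow> 'a set set \<Rightarrow> 'a set \<Rightarrow> 'a set" where
  "extensions G X S = {i \<in> G - S. insert i S \<in> X}"

definition maximal_in :: "'a set \<Rightarrow> 'a set set \<Rightarrow> 'a set \<Rightarrow> bool" where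
  "maximal_in G X S \<longleftrightarrow> extensions G X S = {}"

definition link_pmf :: "'a set \<Rightarrow> 'a set set \<Rightarrow> 'a set pmf \<Rightarrow> 'a set \<Rightarrow> 'a set pmf" where
  "link_pmf G X \<mu> S =
     proportional_pmf {T. T \<subseteq> G - S \<and> S \<union> T \<in> X} (\<lambda>T. pmf \<mu> (S \<union> T))"

definition tilt_pmf :: "'a set \<Rightarrow> real \<Rightarrow> 'a set pmf \<Rightarrow> 'a set pmf" where
  "tilt_pmf U l \<nu> = proportional_pmf (Pow U) (\<lambda>T. pmf \<nu> T * l ^ card T)"

text \<open>
  Vectors and matrices indexed by a finite set \<open>U\<close> are functions on \<open>'a\<close>; only their values at
  indices in \<open>U\<close> are relevant.
\<close>

definition diag_mat :: "('a \<Rightarrow> real) \<Rightarrow> 'a \<Rightarrow> 'a \<Rightarrow> real" where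
  "diag_mat v = (\<lambda>i j. if i = j then v i else 0)"

definition psd_on :: "'a set \<Rightarrow> ('a \<Rightarrow> 'a \<Rightarrow> real) \<Rightarrow> bool" where
  "psd_on U A \<longleftrightarrow> (\<forall>i\<in>U. \<forall>j\<in>U. A i j = A j i) \<and>
     (\<forall>x :: 'a \<Rightarrow> real. 0 \<le> (\<Sum>i\<in>U. \<Sum>j\<in>U. x i * A i j * x j))"

definition loewner_le_on ::
    "'a set \<Rightarrow> ('a \<Rightarrow> 'a \<Rightarrow> real) \<Rightarrow> ('a \<Rightarrow> 'a \<Rightarrow> real) \<Rightarrow> bool" where
  "loewner_le_on U A B \<longleftrightarrow> psd_on U (\<lambda>i j. B i j - A i j)"

definition ratio_vec :: "'a set pmf \<Rightarrow> 'a set \<Rightarrow> 'a \<Rightarrow> real" where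
  "ratio_vec \<mu> S i = pmf \<mu> (insert i S) / pmf \<mu> S"

definition corr_mat :: "'a set \<Rightarrow> 'a set set \<Rightarrow> 'a set pmf \<Rightarrow> 'a set \<Rightarrow> 'a \<Rightarrow> 'a \<Rightarrow> real" where
  "corr_mat G X \<mu> S i j = (let \<nu> = link_pmf G X \<mu> S in
     if i = j then 0 else pmf \<nu> {i, j} * pmf \<nu> {} / (pmf \<nu> {i} * pmf \<nu> {j}) - 1)"

definition mean_vec :: "'a set pmf \<Rightarrow> 'a \<Rightarrow> real" where
  "mean_vec \<nu> i = measure_pmf.expectation \<nu> (\<lambda>T. indicator T i)"

definition cov_mat :: "'a set pmf \<Rightarrow> 'a \<Rightarrow> 'a \<Rightarrow> real" where
  "cov_mat \<nu> i j = measure_pmf.expectation \<nu>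
     (\<lambda>T. (indicator T i - mean_vec \<nu> i) * (indicator T j - mean_vec \<nu> j))"

text \<open>
  Under the standing assumptions the normalisations above are by positive constants, and the
  inverse of $\mathrm{diag}(\mathbf{r}_S)$ on $V_S$ is the diagonal matrix of the reciprocals.
\<close>

lemma pmf_link_pmf:
  assumes "finite G" "X \<subseteq> Pow G" "fully_supported_on \<mu> X" "S \<in> X"
  shows "pmf (link_pmf G X \<mu> S) T =
    (if T \<subseteq> G - S \<and> S \<union> T \<in> X
     then pmf \<mu> (S \<union> T) / (\<Sum>T' | T' \<subseteq> G - S \<and> S \<union> T' \<in> X. pmf \<mu> (S \<union> T')) else 0)"
proof -
  let ?A = "{T. T \<subseteq> G - S \<and> S \<union> T \<in> X}"
  have fin: "finite ?A"
    by (rule finite_subset[of _ "Pow G"]) (use assms(1) in auto)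
  have "0 < pmf \<mu> (S \<union> {})"
    using assms(3,4) by (simp add: fully_supported_on_def)
  hence "0 < (\<Sum>T\<in>?A. pmf \<mu> (S \<union> T))"
    by (intro sum_pos2[OF fin, of "{}"]) (use assms(4) in auto)
  from pmf_proportional_pmf[OF fin _ this, of T] show ?thesis
    by (simp add: link_pmf_def)
qed

lemma pmf_tilt_pmf:
  assumes "finite U" "set_pmf \<nu> \<subseteq> Pow U" "l > 0"
  shows "pmf (tilt_pmf U l \<nu>) T =
    (if T \<subseteq> U then pmf \<nu> T * l ^ card T / (\<Sum>T'\<in>Pow U. pmf \<nu> T' * l ^ card T') else 0)"
proof -
  obtain T0 where T0: "T0 \<in> set_pmf \<nu>"
    using set_pmf_not_empty by fast
  hence "0 < pmf \<nu> T0 * l ^ card T0"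
    using assms(3) by (simp add: pmf_positive)
  hence "0 < (\<Sum>T'\<in>Pow U. pmf \<nu> T' * l ^ card T')"
    by (intro sum_pos2[of "Pow U" T0]) (use assms T0 in auto)
  from pmf_proportional_pmf[OF _ _ this, of T] assms show ?thesis
    by (auto simp: tilt_pmf_def)
qed

lemma diag_mat_ratio_vec_inverse:
  assumes "finite G" "fully_supported_on \<mu> X" "S \<in> X"
    and "i \<in> extensions G X S" "j \<in> extensions G X S"
  shows "(\<Sum>k\<in>extensions G X S.
      diag_mat (ratio_vec \<mu> S) i k * diag_mat (\<lambda>i. inverse (ratio_vec \<mu> S i)) k j) =
    (if i = j then 1 else 0)"
proof -
  have fin: "finite (extensions G X S)"
    using assms(1) by (auto simp: extensions_def)
  have "pmf \<mu> S > 0" "pmf \<mu> (insert i S) > 0"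
    using assms by (auto simp: fully_supported_on_def extensions_def)
  hence "ratio_vec \<mu> S i \<noteq> 0"
    by (simp add: ratio_vec_def)
  moreover have "(\<Sum>k\<in>extensions G X S.
      diag_mat (ratio_vec \<mu> S) i k * diag_mat (\<lambda>i. inverse (ratio_vec \<mu> S i)) k j) =
    (\<Sum>k\<in>extensions G X S. if i = k then
      ratio_vec \<mu> S i * diag_mat (\<lambda>i. inverse (ratio_vec \<mu> S i)) i j else 0)"
    by (intro sum.cong) (auto simp: diag_mat_def)
  ultimately show ?thesis
    using fin assms(4) by (auto simp: diag_mat_def)
qed

end

theory Submission
  imports Defs
begin

text \<open>
  Let $Z_S(t) = \sum_T \mu(S \cup T)\, t^{|T|}$, so that $Z_S' = \sum_i Z_{S \cup i}$. With
  $p_i = Z_{S\cup i}$ and $q_{ij} = Z_{S\cup\{i,j\}}$, $q_{ii} = 0$, all at $t = 1 - \theta$, the conclusion is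
  equivalent to the nonnegativity of
  $g(t) = k \sum_i p_i x_i^2 - x^{\intercal} q x + (\sum_i p_i x_i)^2 / Z_S$ for
  $k(t) = (1-\delta) / (1 - (1-\delta) t)$, and the hypothesis is the case $t = 0$. If the
  inequality is known for all $S \cup \{i\}$, then
  $g' \ge k' \sum_i p_i x_i^2 - \sum_i p_i \left((qx)_i / p_i - (\sum_j p_j x_j) / Z_S\right)^2$.
  On the kernel of the form the right-hand side is $(k' - k^2) \sum_i p_i x_i^2$, which is positive for
  a slightly enlarged $k$. So the enlarged form cannot degenerate, and a limit gives the claim.
\<close>

section \<open>Quadratic forms over a finite index set and a first-degeneration argument\<close>

definition quad :: "'a set \<Rightarrow> ('a \<Rightarrow> 'a \<Rightarrow> real) \<Rightarrow> ('a \<Rightarrow> real) \<Rightarrow> real" where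
  "quad V A x = (\<Sum>i\<in>V. \<Sum>j\<in>V. x i * A i j * x j)"

lemma quad_scale: "quad V A (\<lambda>i. c * x i) = c\<^sup>2 * quad V A x"
  by (simp add: quad_def sum_distrib_left power2_eq_square mult_ac)

text \<open>Functions carry the product topology here. Fixing the value 0 outside \<open>V\<close>
  puts the sphere inside a product of compact sets, so Tychonoff's theorem applies even if the index
  type is infinite.\<close>

lemma compact_unit_sphere_supported:
  assumes "finite V"
  shows "compact {x :: 'a \<Rightarrow> real. (\<forall>i. i \<notin> V \<longrightarrow> x i = 0) \<and> (\<Sum>i\<in>V. (x i)\<^sup>2) = 1}"
proof -
  let ?C = "PiE UNIV (\<lambda>i. if i \<in> V then {-1..1} else {0 :: real})"
  have "compactin (product_topology (\<lambda>_. euclidean) UNIV) ?C"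
    by (subst compactin_PiE) auto
  hence "compact ?C"
    by (simp add: euclidean_product_topology)
  moreover have "closed {x :: 'a \<Rightarrow> real. (\<Sum>i\<in>V. (x i)\<^sup>2) = 1}"
    by (intro closed_Collect_eq continuous_intros) auto
  ultimately have "compact (?C \<inter> {x. (\<Sum>i\<in>V. (x i)\<^sup>2) = 1})"
    by (rule compact_Int_closed)
  also have "?C \<inter> {x. (\<Sum>i\<in>V. (x i)\<^sup>2) = 1} =
      {x. (\<forall>i. i \<notin> V \<longrightarrow> x i = 0) \<and> (\<Sum>i\<in>V. (x i)\<^sup>2) = 1}" (is "?L = ?R")
  proof
    show "?L \<subseteq> ?R" by (auto simp: PiE_def Pi_def split: if_splits)
    show "?R \<subseteq> ?L"
    proof
      fix x assume x: "x \<in> ?R"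
      have "\<bar>x i\<bar> \<le> 1" if "i \<in> V" for i
      proof -
        have "(x i)\<^sup>2 \<le> (\<Sum>i\<in>V. (x i)\<^sup>2)"
          by (rule member_le_sum) (use assms that in auto)
        thus ?thesis using x by (simp add: abs_square_le_1)
      qed
      thus "x \<in> ?L" using x by (fastforce simp: PiE_def Pi_def abs_le_iff)
    qed
  qed
  finally show ?thesis .
qed

text \<open>A zero of a nonnegative form is a minimum, so the first variation in each coordinate
  direction vanishes. Moving by \<open>s\<close> in direction \<open>i\<close> changes the value by
  \<open>2 * s * b + s\<^sup>2 * A i i\<close>, which a suitable \<open>s\<close> makes negative
  unless \<open>b\<close> is 0.\<close>

lemma quad_nonneg_null:
  assumes fin: "finite V" and sym: "\<And>i j. A i j = A j i"
    and nonneg: "\<And>x. 0 \<le> quad V A x" and null: "quad V A x = 0" and i: "i \<in> V"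
  shows "(\<Sum>j\<in>V. A i j * x j) = 0"
proof (rule ccontr)
  define b where "b = (\<Sum>j\<in>V. A i j * x j)"
  \<comment> \<open>Any positive \<open>d\<close> above \<open>A i i / 2\<close> would do: the step
    \<open>s = - b / d\<close> then yields \<open>(b / d)\<^sup>2 * (A i i - 2 * d)\<close>, which
    is negative for nonzero \<open>b\<close>.\<close>
  define d where "d = \<bar>A i i\<bar> + 1"
  assume "(\<Sum>j\<in>V. A i j * x j) \<noteq> 0"
  hence b: "b \<noteq> 0" by (simp add: b_def)
  have b': "(\<Sum>k\<in>V. x k * A k i) = b"
    unfolding b_def by (intro sum.cong) (auto simp: sym[of i])
  have expand: "quad V A (\<lambda>k. x k + s * of_bool (k = i)) = 2 * s * b + s\<^sup>2 * A i i" for s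
  proof -
    have "quad V A (\<lambda>k. x k + s * of_bool (k = i)) =
      quad V A x + (\<Sum>k\<in>V. \<Sum>j\<in>V. x k * A k j * (s * of_bool (j = i)))
        + (\<Sum>k\<in>V. \<Sum>j\<in>V. s * of_bool (k = i) * A k j * x j)
        + (\<Sum>k\<in>V. \<Sum>j\<in>V. s * of_bool (k = i) * A k j * (s * of_bool (j = i)))"
      by (simp add: quad_def algebra_simps sum.distrib)
    also have "(\<Sum>k\<in>V. \<Sum>j\<in>V. x k * A k j * (s * of_bool (j = i))) = s * b"
      using fin i by (simp add: b'[symmetric] sum_distrib_left of_bool_def if_distrib[of "\<lambda>z. _ * z"] mult_ac cong: if_cong)
    also have "(\<Sum>k\<in>V. \<Sum>j\<in>V. s * of_bool (k = i) * A k j * x j) =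
        (\<Sum>k\<in>V. if k = i then s * b else 0)"
      by (intro sum.cong) (auto simp: b_def sum_distrib_left mult_ac)
    also have "(\<Sum>k\<in>V. if k = i then s * b else 0) = s * b"
      using fin i by simp
    also have "(\<Sum>k\<in>V. \<Sum>j\<in>V. s * of_bool (k = i) * A k j * (s * of_bool (j = i))) =
        (\<Sum>k\<in>V. if k = i then s\<^sup>2 * A i i else 0)"
      using fin i by (intro sum.cong) (auto simp: of_bool_def if_distrib[of "\<lambda>z. _ * z"] power2_eq_square mult_ac cong: if_cong)
    also have "\<dots> = s\<^sup>2 * A i i"
      using fin i by simp
    finally show ?thesis using null by simp
  qed
  have d: "d > 0" "A i i < d" by (auto simp: d_def)
  have "0 \<le> 2 * (- b / d) * b + (- b / d)\<^sup>2 * A i i"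
    using nonneg[of "\<lambda>k. x k + (- b / d) * of_bool (k = i)"] unfolding expand .
  also have "\<dots> = (b / d)\<^sup>2 * (A i i - 2 * d)"
    using d by (simp add: field_simps power2_eq_square)
  also have "\<dots> < 0"
    using b d by (intro mult_pos_neg) auto
  finally show False by simp
qed

text \<open>At the first time the form degenerates it is still positive semidefinite, so a vector on which
  it vanishes lies in its kernel; along that vector the form cannot be increasing.\<close>

lemma quad_pos_barrier:
  fixes A :: "real \<Rightarrow> 'a \<Rightarrow> 'a \<Rightarrow> real"
  assumes fin: "finite V"
    and cont: "\<And>i j. i \<in> V \<Longrightarrow> j \<in> V \<Longrightarrow> continuous_on {0..T} (\<lambda>t. A t i j)"
    and sym: "\<And>t i j. A t i j = A t j i"
    and init: "\<And>x. \<exists>i\<in>V. x i \<noteq> 0 \<Longrightarrow> 0 < quad V (A 0) x"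
    and step: "\<And>t x. 0 < t \<Longrightarrow> t \<le> T \<Longrightarrow> \<exists>i\<in>V. x i \<noteq> 0 \<Longrightarrow> \<forall>i. i \<notin> V \<longrightarrow> x i = 0 \<Longrightarrow>
      \<forall>i\<in>V. (\<Sum>j\<in>V. A t i j * x j) = 0 \<Longrightarrow>
      \<exists>d>0. ((\<lambda>s. quad V (A s) x) has_real_derivative d) (at t)"
    and t: "0 \<le> t" "t \<le> T" and x: "\<exists>i\<in>V. x i \<noteq> 0"
  shows "0 < quad V (A t) x"
proof -
  define K where "K = {x :: 'a \<Rightarrow> real. (\<forall>i. i \<notin> V \<longrightarrow> x i = 0) \<and> (\<Sum>i\<in>V. (x i)\<^sup>2) = 1}"
  define f where "f = (\<lambda>p :: real \<times> ('a \<Rightarrow> real). quad V (A (fst p)) (snd p))"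
  \<comment> \<open>The pairs of a time and a unit vector at which positivity fails. This set is
    compact, so if it is nonempty it has a point with least time.\<close>
  define B where "B = ({0..T} \<times> K) \<inter> f -` {..0}"
  \<comment> \<open>By homogeneity, signs need checking only on \<open>K\<close>. The factor
    \<open>c\<close> is the same at all times.\<close>
  have normalize: "\<exists>y\<in>K. \<exists>c>0. \<forall>s. quad V (A s) y = c * quad V (A s) x"
    if x: "\<exists>i\<in>V. x i \<noteq> 0" for x
  proof -
    define r where "r = (\<Sum>i\<in>V. (x i)\<^sup>2)"
    obtain i where "i \<in> V" "x i \<noteq> 0" using x by blast
    hence r: "r > 0" unfolding r_def using fin by (intro sum_pos2[of V i]) auto
    define y where "y = (\<lambda>i. if i \<in> V then 1 / sqrt r * x i else 0)"
    have "(\<Sum>i\<in>V. (y i)\<^sup>2) = (\<Sum>i\<in>V. (x i)\<^sup>2 / r)"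
      unfolding y_def using r by (intro sum.cong) (auto simp: power_divide)
    hence "y \<in> K"
      using r by (simp add: K_def y_def r_def flip: sum_divide_distrib)
    moreover have "quad V (A s) y = (1 / sqrt r)\<^sup>2 * quad V (A s) x" for s
      unfolding quad_scale[symmetric] by (simp add: quad_def y_def)
    ultimately show ?thesis using r by (intro bexI[of _ y] exI[of _ "(1 / sqrt r)\<^sup>2"]) auto
  qed
  have "B = {}"
  proof (rule ccontr)
    assume "B \<noteq> {}"
    have "compact ({0..T} \<times> K)"
      unfolding K_def by (intro compact_Times compact_unit_sphere_supported fin) auto
    moreover have "closedin (top_of_set ({0..T} \<times> K)) B"
      unfolding B_def
    proof (rule continuous_closedin_preimage)
      show "continuous_on ({0..T} \<times> K) f"
        unfolding f_def quad_def
      proof (intro continuous_intros)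
        fix i j assume ij: "i \<in> V" "j \<in> V"
        show "continuous_on ({0..T} \<times> K) (\<lambda>p. A (fst p) i j)"
          by (rule continuous_on_compose2[OF cont[OF ij]]) (auto intro: continuous_on_fst)
        show "continuous_on ({0..T} \<times> K) (\<lambda>p. snd p i)"
             "continuous_on ({0..T} \<times> K) (\<lambda>p. snd p j)"
          by (rule continuous_on_product_then_coordinatewise[OF continuous_on_snd[OF continuous_on_id]])+
      qed
    qed simp
    ultimately have "compact B"
      by (rule closedin_compact)
    moreover have "continuous_on B fst"
      by (intro continuous_on_fst continuous_on_id)
    ultimately obtain p where p: "p \<in> B" "\<And>q. q \<in> B \<Longrightarrow> fst p \<le> fst q"
      using continuous_attains_inf[of B fst] \<open>B \<noteq> {}\<close> by blast
    obtain t0 x0 where tx: "p = (t0, x0)" by (cases p)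
    have t0: "0 \<le> t0" "t0 \<le> T" and x0: "x0 \<in> K" and le: "quad V (A t0) x0 \<le> 0"
      using p(1) by (auto simp: tx B_def f_def)
    have supp: "\<forall>i. i \<notin> V \<longrightarrow> x0 i = 0"
      using x0 by (simp add: K_def)
    have ne0: "\<exists>i\<in>V. x0 i \<noteq> 0"
    proof (rule ccontr)
      assume "\<not> (\<exists>i\<in>V. x0 i \<noteq> 0)"
      hence "(\<Sum>i\<in>V. (x0 i)\<^sup>2) = 0" by simp
      thus False using x0 by (simp add: K_def)
    qed
    have before: "0 < quad V (A s) y" if s: "0 \<le> s" "s < t0" and y: "\<exists>i\<in>V. y i \<noteq> 0" for s y
    proof -
      obtain z c where z: "z \<in> K" "c > 0" "quad V (A s) z = c * quad V (A s) y"
        using normalize[OF y] by blast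
      have "(s, z) \<notin> B" using p(2)[of "(s, z)"] s by (auto simp: tx)
      hence "0 < quad V (A s) z" using s t0 z by (auto simp: B_def f_def)
      thus ?thesis using z by (simp add: zero_less_mult_iff)
    qed
    have "t0 \<noteq> 0" using init[OF ne0] le by auto
    with t0 have t0_pos: "0 < t0" by simp
    \<comment> \<open>Positivity is known only before \<open>t0\<close>, so the value at
      \<open>t0\<close> is bounded as a limit from the left; that filter is nontrivial because
      \<open>t0\<close> is positive.\<close>
    have at_t0: "0 \<le> quad V (A t0) y" for y
    proof (cases "\<exists>i\<in>V. y i \<noteq> 0")
      case True
      have "continuous_on {0..T} (\<lambda>s. quad V (A s) y)"
        unfolding quad_def by (intro continuous_intros cont)
      hence "((\<lambda>s. quad V (A s) y) \<longlongrightarrow> quad V (A t0) y) (at t0 within {0..T})"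
        using t0 by (simp add: continuous_on_def)
      hence "((\<lambda>s. quad V (A s) y) \<longlongrightarrow> quad V (A t0) y) (at t0 within {0..<t0})"
        by (rule tendsto_within_subset) (use t0 in auto)
      moreover have "at t0 within {0..<t0} \<noteq> bot"
      proof -
        have "at t0 within {0..<t0} = at_left t0"
          by (rule at_within_nhd[of _ "{0<..}"]) (use t0_pos in auto)
        thus ?thesis by simp
      qed
      moreover have "eventually (\<lambda>s. 0 \<le> quad V (A s) y) (at t0 within {0..<t0})"
        unfolding eventually_at_filter using before True by (intro always_eventually) (auto intro: less_imp_le)
      ultimately show ?thesis
        using tendsto_lowerbound by blast
    next
      case False
      thus ?thesis by (simp add: quad_def)
    qed
    with le have null: "quad V (A t0) x0 = 0" by (simp add: antisym)
    have "\<forall>i\<in>V. (\<Sum>j\<in>V. A t0 i j * x0 j) = 0"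
      using quad_nonneg_null[OF fin sym at_t0 null] by blast
    then obtain d where "d > 0" "((\<lambda>s. quad V (A s) x0) has_real_derivative d) (at t0)"
      using step[OF t0_pos t0(2) ne0 supp] by blast
    \<comment> \<open>The form vanishes at \<open>t0\<close> along \<open>x0\<close> with positive
      derivative, so it is negative shortly before \<open>t0\<close>, contrary to
      \<open>before\<close>. The choice of \<open>h\<close> below keeps the time
      nonnegative.\<close>
    then obtain e where e: "e > 0" "\<And>h. 0 < h \<Longrightarrow> h < e \<Longrightarrow> quad V (A (t0 - h)) x0 < quad V (A t0) x0"
      using DERIV_pos_inc_left by blast
    define h where "h = min e t0 / 2"
    have "0 < h" "h < e" "h < t0" using e(1) t0_pos by (auto simp: h_def)
    thus False using e(2)[of h] before[of "t0 - h" x0] ne0 null by auto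
  qed
  obtain z c where z: "z \<in> K" "c > 0" "quad V (A t) z = c * quad V (A t) x"
    using normalize[OF x] by blast
  have "(t, z) \<notin> B" using \<open>B = {}\<close> by simp
  hence "0 < quad V (A t) z" using z(1) t by (simp add: B_def f_def)
  thus ?thesis using z by (simp add: zero_less_mult_iff)
qed

section \<open>Partition functions of downward closed weights and their derivatives\<close>

lemma sum_Pow_containing:
  assumes "i \<in> U"
  shows "(\<Sum>T\<in>{T \<in> Pow U. i \<in> T}. h T) = (\<Sum>T\<in>Pow (U - {i}). h (insert i T))"
  by (rule sum.reindex_bij_witness[of _ "insert i" "\<lambda>T. T - {i}"])
    (use assms in \<open>auto simp: insert_absorb\<close>)

locale downward_weight =
  fixes G :: "'a set" and w :: "'a set \<Rightarrow> real"
  assumes finite_ground: "finite G"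
    and weight_nonneg: "0 \<le> w T"
    and weight_downward: "S \<subseteq> T \<Longrightarrow> 0 < w T \<Longrightarrow> 0 < w S"
begin

definition partition_fun :: "'a set \<Rightarrow> real \<Rightarrow> real" where
  "partition_fun S t = (\<Sum>T\<in>Pow (G - S). w (S \<union> T) * t ^ card T)"

text \<open>These are the first partial derivatives, at the point with all variables equal to
  \<open>t\<close>, of the multiaffine polynomial with coefficients \<open>w (S \<union> T)\<close>.
  It does not involve the variables in \<open>S\<close>, hence the value 0 there. Likewise
  \<open>hess\<close> collects the second partial derivatives, with zero diagonal by
  multiaffinity.\<close>

definition grad :: "'a set \<Rightarrow> real \<Rightarrow> 'a \<Rightarrow> real" where
  "grad S t i = (if i \<in> S then 0 else partition_fun (insert i S) t)"

definition hess :: "'a set \<Rightarrow> real \<Rightarrow> 'a \<Rightarrow> 'a \<Rightarrow> real" where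
  "hess S t i j = (if i \<in> S then 0 else grad (insert i S) t j)"

text \<open>For \<open>k = \<kappa> / (1 - \<kappa> * t)\<close>, multiplying by
  \<open>t\<^sup>2 / partition_fun S t\<close> gives the difference of the two sides of the
  covariance bound. At \<open>t = 0\<close> with \<open>k = \<kappa>\<close> it is a diagonal
  congruence of the difference in the hypothesis. Clearing these factors makes one family
  interpolate between the two.\<close>

definition gap_mat :: "real \<Rightarrow> 'a set \<Rightarrow> real \<Rightarrow> 'a \<Rightarrow> 'a \<Rightarrow> real" where
  "gap_mat k S t i j = k * diag_mat (grad S t) i j - hess S t i j
     + grad S t i * grad S t j / partition_fun S t"

lemma hess_sym: "hess S t i j = hess S t j i"
  by (auto simp: hess_def grad_def insert_commute)

lemma gap_mat_sym: "gap_mat k S t i j = gap_mat k S t j i"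
  by (simp add: gap_mat_def hess_sym[of S t i j] diag_mat_def)

lemma quad_gap_mat:
  "quad G (gap_mat k S t) x = k * (\<Sum>i\<in>G. grad S t i * (x i)\<^sup>2) - quad G (hess S t) x
     + (\<Sum>i\<in>G. grad S t i * x i)\<^sup>2 / partition_fun S t"
proof -
  have "(\<Sum>i\<in>G. \<Sum>j\<in>G. x i * (k * diag_mat (grad S t) i j) * x j) =
      (\<Sum>i\<in>G. \<Sum>j\<in>G. if i = j then k * (grad S t i * (x i)\<^sup>2) else 0)"
    by (intro sum.cong) (auto simp: diag_mat_def power2_eq_square)
  also have "\<dots> = k * (\<Sum>i\<in>G. grad S t i * (x i)\<^sup>2)"
    using finite_ground by (simp add: sum_distrib_left)
  finally have diag: "(\<Sum>i\<in>G. \<Sum>j\<in>G. x i * (k * diag_mat (grad S t) i j) * x j) = \<dots>" .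
  have rank1: "(\<Sum>i\<in>G. \<Sum>j\<in>G. x i * (grad S t i * grad S t j / partition_fun S t) * x j) =
      (\<Sum>i\<in>G. grad S t i * x i)\<^sup>2 / partition_fun S t"
    unfolding power2_eq_square sum_product sum_divide_distrib
    by (intro sum.cong) (auto simp: mult_ac)
  have "quad G (gap_mat k S t) x =
      (\<Sum>i\<in>G. \<Sum>j\<in>G. x i * (k * diag_mat (grad S t) i j) * x j) - quad G (hess S t) x
      + (\<Sum>i\<in>G. \<Sum>j\<in>G. x i * (grad S t i * grad S t j / partition_fun S t) * x j)"
    unfolding quad_def gap_mat_def
    by (simp only: distrib_left distrib_right left_diff_distrib right_diff_distrib
        sum.distrib sum_subtractf)
  thus ?thesis unfolding diag rank1 .
qed

lemma partition_fun_pos: "0 < w S \<Longrightarrow> 0 \<le> t \<Longrightarrow> 0 < partition_fun S t"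
  unfolding partition_fun_def
  by (rule sum_pos2[of _ "{}"]) (use finite_ground weight_nonneg in auto)

lemma partition_fun_eq_0: "\<not> 0 < w S \<Longrightarrow> partition_fun S t = 0"
  unfolding partition_fun_def
proof (intro sum.neutral ballI)
  fix T assume "\<not> 0 < w S"
  hence "w (S \<union> T) = 0"
    using weight_downward[of S "S \<union> T"] weight_nonneg[of "S \<union> T"] by force
  thus "w (S \<union> T) * t ^ card T = 0" by simp
qed

lemma partition_fun_0: "partition_fun S 0 = w S"
proof -
  have "partition_fun S 0 = (\<Sum>T\<in>Pow (G - S). if T = {} then w S else 0)"
    unfolding partition_fun_def
    using finite_ground by (intro sum.cong) (auto simp: power_0_left dest: finite_subset)
  thus ?thesis using finite_ground by simp
qed

lemma grad_nonneg: "0 \<le> t \<Longrightarrow> 0 \<le> grad S t i"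
  using partition_fun_pos[of "insert i S" t] partition_fun_eq_0[of "insert i S" t]
  by (cases "0 < w (insert i S)") (auto simp: grad_def)

lemma hess_eq_0:
  assumes "i \<in> S \<or> \<not> 0 < w (insert i S)"
  shows "hess S t i j = 0"
proof (cases "i \<in> S")
  case False
  hence "\<not> 0 < w (insert j (insert i S))"
    using assms weight_downward[of "insert i S" "insert j (insert i S)"] by blast
  thus ?thesis by (simp add: hess_def grad_def partition_fun_eq_0)
qed (simp add: hess_def)

text \<open>The factor \<open>card T\<close> from differentiating a power counts the elements
  \<open>i\<close> of \<open>T\<close>. Exchanging the sums and deleting \<open>i\<close> from
  \<open>T\<close> turns the terms for \<open>i\<close> into the partition function of
  \<open>insert i S\<close>.\<close>

lemma DERIV_partition_fun:
  "(partition_fun S has_real_derivative (\<Sum>i\<in>G. grad S t i)) (at t)"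
proof -
  let ?U = "G - S"
  have fin: "finite ?U" using finite_ground by simp
  have "(\<Sum>T\<in>Pow ?U. w (S \<union> T) * (real (card T) * t ^ (card T - 1))) =
      (\<Sum>T\<in>Pow ?U. \<Sum>i\<in>?U. if i \<in> T then w (S \<union> T) * t ^ (card T - 1) else 0)"
  proof (intro sum.cong refl)
    fix T assume "T \<in> Pow ?U"
    hence "?U \<inter> {i. i \<in> T} = T" by auto
    thus "w (S \<union> T) * (real (card T) * t ^ (card T - 1)) =
        (\<Sum>i\<in>?U. if i \<in> T then w (S \<union> T) * t ^ (card T - 1) else 0)"
      using fin by (simp add: sum.If_cases)
  qed
  also have "\<dots> = (\<Sum>i\<in>?U. \<Sum>T\<in>{T \<in> Pow ?U. i \<in> T}. w (S \<union> T) * t ^ (card T - 1))"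
    by (subst sum.swap, intro sum.cong refl sum.inter_filter[symmetric]) (simp add: fin)
  also have "\<dots> = (\<Sum>i\<in>?U. grad S t i)"
  proof (intro sum.cong refl)
    fix i assume i: "i \<in> ?U"
    have "w (S \<union> insert i T) * t ^ (card (insert i T) - 1) = w (insert i S \<union> T) * t ^ card T"
      if "T \<in> Pow (?U - {i})" for T
    proof -
      have "finite T" "i \<notin> T" using that finite_subset[of T ?U] fin by auto
      thus ?thesis by simp
    qed
    hence "(\<Sum>T\<in>Pow (?U - {i}). w (S \<union> insert i T) * t ^ (card (insert i T) - 1)) =
        (\<Sum>T\<in>Pow (?U - {i}). w (insert i S \<union> T) * t ^ card T)"
      by (intro sum.cong) auto
    also have "\<dots> = grad S t i"
    proof -
      have "?U - {i} = G - insert i S" by auto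
      thus ?thesis using i by (simp add: grad_def partition_fun_def)
    qed
    finally have "(\<Sum>T\<in>Pow (?U - {i}). w (S \<union> insert i T) * t ^ (card (insert i T) - 1)) =
        grad S t i" .
    thus "(\<Sum>T\<in>{T \<in> Pow ?U. i \<in> T}. w (S \<union> T) * t ^ (card T - 1)) = grad S t i"
      by (simp only: sum_Pow_containing[OF i])
  qed
  also have "\<dots> = (\<Sum>i\<in>G. grad S t i)"
    using finite_ground by (intro sum.mono_neutral_left) (auto simp: grad_def)
  finally have eq: "(\<Sum>T\<in>Pow ?U. w (S \<union> T) * (real (card T) * t ^ (card T - 1))) = \<dots>" .
  show ?thesis
    unfolding partition_fun_def[abs_def] eq[symmetric]
    by (auto intro!: derivative_eq_intros simp: mult_ac)
qed

lemma DERIV_grad: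
  "((\<lambda>t. grad S t i) has_real_derivative (\<Sum>j\<in>G. hess S t i j)) (at t)"
  using DERIV_partition_fun[of "insert i S" t] by (cases "i \<in> S") (simp_all add: grad_def hess_def)

text \<open>Third partial derivatives are symmetric, so the new index \<open>m\<close> can be moved
  into the conditioning set. This is how the forms of the links enter the derivative of the form at
  \<open>S\<close>.\<close>

lemma DERIV_hess:
  "((\<lambda>t. hess S t i j) has_real_derivative
     (\<Sum>m\<in>G. if m \<in> S then 0 else hess (insert m S) t i j)) (at t)"
proof (cases "i \<in> S")
  case False
  have "hess (insert i S) t j m = (if m \<in> S then 0 else hess (insert m S) t i j)" for m
    using False by (auto simp: hess_def grad_def insert_commute)
  thus ?thesis
    using DERIV_grad[of "insert i S" j t] False by (simp add: hess_def)
qed (simp add: hess_def cong: if_cong)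

lemma DERIV_quad_hess:
  "((\<lambda>t. quad G (hess S t) x) has_real_derivative
     (\<Sum>m\<in>G. if m \<in> S then 0 else quad G (hess (insert m S) t) x)) (at t)"
proof -
  have "(\<Sum>i\<in>G. \<Sum>j\<in>G. x i * (\<Sum>m\<in>G. if m \<in> S then 0 else hess (insert m S) t i j) * x j) =
      (\<Sum>m\<in>G. \<Sum>i\<in>G. \<Sum>j\<in>G. x i * (if m \<in> S then 0 else hess (insert m S) t i j) * x j)"
    unfolding sum_distrib_left sum_distrib_right
    by (subst sum.swap[of _ G G], subst (2) sum.swap) (rule refl)
  also have "\<dots> = (\<Sum>m\<in>G. if m \<in> S then 0 else quad G (hess (insert m S) t) x)"
    by (intro sum.cong refl) (auto simp: quad_def)
  finally have eq: "(\<Sum>m\<in>G. if m \<in> S then 0 else quad G (hess (insert m S) t) x) =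
    (\<Sum>i\<in>G. \<Sum>j\<in>G. x i * (\<Sum>m\<in>G. if m \<in> S then 0 else hess (insert m S) t i j) * x j)" ..
  show ?thesis
    unfolding quad_def[of G "hess S _"] eq
    by (intro DERIV_sum DERIV_cmult_right DERIV_cmult DERIV_hess)
qed

section \<open>Support, growth in \<open>t\<close> and nonnegativity of the gap form\<close>

lemma gap_mat_eq_0:
  assumes "i \<in> S \<or> \<not> 0 < w (insert i S)"
  shows "gap_mat k S t i j = 0" "gap_mat k S t j i = 0"
proof -
  have "grad S t i = 0"
    using assms by (auto simp: grad_def partition_fun_eq_0)
  thus "gap_mat k S t i j = 0"
    using hess_eq_0[OF assms] by (auto simp: gap_mat_def diag_mat_def)
  thus "gap_mat k S t j i = 0"
    by (simp add: gap_mat_sym)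
qed

text \<open>Rows and columns outside the extensions of \<open>S\<close> vanish. All links can
  therefore share the index set \<open>G\<close>, while strict positivity is discussed on a smaller
  one.\<close>

lemma quad_gap_mat_restrict:
  assumes "V \<subseteq> G" and "\<And>i. i \<in> G - V \<Longrightarrow> i \<in> S \<or> \<not> 0 < w (insert i S)"
  shows "quad V (gap_mat k S t) x = quad G (gap_mat k S t) x"
proof -
  have outside: "gap_mat k S t i j = 0" "gap_mat k S t j i = 0" if "i \<in> G - V" for i j
    using gap_mat_eq_0[OF assms(2)[OF that]] by auto
  have "quad G (gap_mat k S t) x = (\<Sum>i\<in>V. \<Sum>j\<in>G. x i * gap_mat k S t i j * x j)"
    unfolding quad_def using assms(1) finite_ground outside by (intro sum.mono_neutral_right) auto
  also have "\<dots> = quad V (gap_mat k S t) x"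
    unfolding quad_def using assms(1) finite_ground outside
    by (intro sum.cong sum.mono_neutral_right) auto
  finally show ?thesis ..
qed

text \<open>The link inequalities bound the derivative of the Hessian term by squares, and the
  kernel equations evaluate these squares exactly. All terms with \<open>L\<close>, \<open>P\<close>
  or \<open>D'\<close> then cancel.\<close>

lemma quad_gap_mat_deriv_pos:
  fixes k :: "real \<Rightarrow> real" and k' :: real
  assumes S: "0 < w S" and t: "0 \<le> t" and k': "(k has_real_derivative k') (at t)" "(k t)\<^sup>2 < k'"
    and link: "\<And>m. m \<in> G - S \<Longrightarrow> 0 < w (insert m S) \<Longrightarrow> 0 \<le> quad G (gap_mat (k t) (insert m S) t) x"
    and null: "\<And>i. i \<in> G \<Longrightarrow> (\<Sum>j\<in>G. gap_mat (k t) S t i j * x j) = 0"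
    and x: "0 < (\<Sum>i\<in>G. grad S t i * (x i)\<^sup>2)"
  shows "\<exists>d>0. ((\<lambda>s. quad G (gap_mat (k s) S s) x) has_real_derivative d) (at t)"
proof -
  define Z where "Z = partition_fun S t"
  define p where "p = grad S t"
  define q where "q = hess S t"
  define P where "P = (\<Sum>i\<in>G. p i)"
  define L where "L = (\<Sum>i\<in>G. p i * x i)"
  define D where "D = (\<Sum>i\<in>G. p i * (x i)\<^sup>2)"
  define L' where "L' = (\<Sum>i\<in>G. (\<Sum>j\<in>G. q i j) * x i)"
  define D' where "D' = (\<Sum>i\<in>G. (\<Sum>j\<in>G. q i j) * (x i)\<^sup>2)"
  define Q' where "Q' = (\<Sum>m\<in>G. if m \<in> S then 0 else quad G (hess (insert m S) t) x)"
  define c where "c = (\<lambda>i. \<Sum>j\<in>G. q i j * x j)"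
  have Z: "Z > 0" using partition_fun_pos[OF S t] by (simp add: Z_def)
  \<comment> \<open>The product and quotient rules: \<open>D'\<close>, \<open>Q'\<close>,
    \<open>L'\<close> and \<open>P\<close> are the derivatives of the diagonal sum, the Hessian
    form, the linear sum and the partition function, with \<open>x\<close> fixed.\<close>
  define d where "d = k' * D + k t * D' - Q' + (2 * L * L' * Z - L\<^sup>2 * P) / Z\<^sup>2"
  have "((\<lambda>s. quad G (gap_mat (k s) S s) x) has_real_derivative d) (at t)"
    unfolding quad_gap_mat
    by (rule derivative_eq_intros k' DERIV_quad_hess DERIV_partition_fun DERIV_grad refl | use Z in \<open>simp add: Z_def; fail\<close>)+
      (use Z in \<open>simp add: d_def D_def D'_def Q'_def L_def L'_def P_def p_def q_def Z_def power2_eq_square algebra_simps\<close>)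
  moreover have "d > 0"
  proof -
    have q_sym: "q i j = q j i" for i j by (simp add: q_def hess_sym)
    \<comment> \<open>Row \<open>i\<close> of the kernel equation, solved for the Hessian
      term.\<close>
    have c_eq: "c i = p i * (k t * x i + L / Z)" if "i \<in> G" for i
    proof -
      have "(\<Sum>j\<in>G. gap_mat (k t) S t i j * x j) =
          (\<Sum>j\<in>G. (if i = j then k t * p i * x i else 0) - q i j * x j + p i / Z * (p j * x j))"
        by (intro sum.cong) (auto simp: gap_mat_def diag_mat_def p_def q_def Z_def algebra_simps)
      also have "\<dots> = k t * p i * x i - c i + p i / Z * L"
        using finite_ground that by (simp add: sum.distrib sum_subtractf c_def L_def sum_distrib_left)
      finally show ?thesis using null[OF that] by (simp add: algebra_simps)
    qed
    have "L' = (\<Sum>i\<in>G. \<Sum>j\<in>G. q i j * x i)"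
      by (simp add: L'_def sum_distrib_right)
    also have "\<dots> = (\<Sum>i\<in>G. c i)"
      unfolding c_def by (subst sum.swap) (simp add: q_sym)
    also have "\<dots> = (\<Sum>i\<in>G. k t * (p i * x i) + L / Z * p i)"
      by (intro sum.cong) (auto simp: c_eq algebra_simps)
    also have "\<dots> = k t * L + L / Z * P"
      by (simp add: sum.distrib L_def P_def sum_distrib_left)
    finally have L': "L' = k t * L + L / Z * P" .
    \<comment> \<open>In the link of \<open>m\<close> the partition function is \<open>p m\<close>
      and the gradient is row \<open>m\<close> of \<open>q\<close>, so the rank-one term of its gap
      form is \<open>(c m)\<^sup>2 / p m\<close>, which \<open>c_eq\<close> rewrites. If
      \<open>m\<close> lies in \<open>S\<close> or is not an extension, the Hessian terms vanish and
      a nonnegative square is left.\<close>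
    have "Q' \<le> (\<Sum>m\<in>G. k t * (\<Sum>j\<in>G. q m j * (x j)\<^sup>2) + p m * (k t * x m + L / Z)\<^sup>2)"
      unfolding Q'_def
    proof (intro sum_mono)
      fix m assume m: "m \<in> G"
      show "(if m \<in> S then 0 else quad G (hess (insert m S) t) x) \<le>
          k t * (\<Sum>j\<in>G. q m j * (x j)\<^sup>2) + p m * (k t * x m + L / Z)\<^sup>2" (is "?l \<le> ?r")
      proof (cases "m \<notin> S \<and> 0 < w (insert m S)")
        case True
        hence p: "p m = partition_fun (insert m S) t" "p m > 0"
          and q: "q m = grad (insert m S) t"
          using partition_fun_pos[of "insert m S" t] t
          by (auto simp: p_def q_def grad_def hess_def fun_eq_iff)
        have "0 \<le> k t * (\<Sum>j\<in>G. q m j * (x j)\<^sup>2) - quad G (hess (insert m S) t) x + (c m)\<^sup>2 / p m"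
          using link[of m] m True unfolding quad_gap_mat c_def p(1) q by simp
        also have "(c m)\<^sup>2 / p m = p m * (k t * x m + L / Z)\<^sup>2"
          using p(2) by (simp add: c_eq[OF m] power2_eq_square)
        finally show ?thesis using True by simp
      next
        case False
        hence "q m j = 0" for j using hess_eq_0[of m S t j] by (auto simp: q_def)
        moreover have "?l = 0"
        proof (cases "m \<in> S")
          case False
          have "hess (insert m S) t i j = 0" for i j
          proof -
            have "\<not> 0 < w (insert i (insert m S))"
              using \<open>\<not> (m \<notin> S \<and> 0 < w (insert m S))\<close> False
                weight_downward[of "insert m S" "insert i (insert m S)"] by blast
            thus ?thesis by (simp add: hess_eq_0)
          qed
          thus ?thesis by (simp add: quad_def)
        qed simp
        moreover have "0 \<le> p m" unfolding p_def by (rule grad_nonneg[OF t])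
        ultimately show ?thesis by simp
      qed
    qed
    also have "\<dots> = k t * (\<Sum>m\<in>G. \<Sum>j\<in>G. q m j * (x j)\<^sup>2)
        + (\<Sum>m\<in>G. (k t)\<^sup>2 * (p m * (x m)\<^sup>2) + 2 * k t * L / Z * (p m * x m) + L\<^sup>2 / Z\<^sup>2 * p m)"
      by (simp add: sum.distrib sum_distrib_left power2_sum algebra_simps power_mult_distrib power_divide)
    also have "(\<Sum>m\<in>G. \<Sum>j\<in>G. q m j * (x j)\<^sup>2) = D'"
      unfolding D'_def sum_distrib_right by (subst sum.swap) (simp add: q_sym)
    also have "(\<Sum>m\<in>G. (k t)\<^sup>2 * (p m * (x m)\<^sup>2) + 2 * k t * L / Z * (p m * x m) + L\<^sup>2 / Z\<^sup>2 * p m) =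
        (k t)\<^sup>2 * D + 2 * k t * L / Z * L + L\<^sup>2 / Z\<^sup>2 * P"
      by (simp only: sum.distrib sum_distrib_left[symmetric] D_def L_def P_def)
    finally have "Q' \<le> k t * D' + ((k t)\<^sup>2 * D + 2 * k t * L / Z * L + L\<^sup>2 / Z\<^sup>2 * P)" .
    \<comment> \<open>Inserting \<open>L'\<close> makes the quotient-rule term equal to the last two
      terms of the bound on \<open>Q'\<close>. After cancellation only \<open>k' * D\<close> and
      \<open>(k t)\<^sup>2 * D\<close> remain.\<close>
    moreover have "(2 * L * L' * Z - L\<^sup>2 * P) / Z\<^sup>2 = 2 * k t * L / Z * L + L\<^sup>2 / Z\<^sup>2 * P"
      using Z by (simp add: L' field_simps power2_eq_square)
    ultimately have "d \<ge> (k' - (k t)\<^sup>2) * D"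
      by (simp add: d_def algebra_simps)
    moreover have "(k' - (k t)\<^sup>2) * D > 0"
      using k'(2) x by (simp add: D_def p_def)
    ultimately show ?thesis by simp
  qed
  ultimately show ?thesis by blast
qed

text \<open>The comparison function \<open>k t = a / (1 - b * t)\<close> satisfies \<open>k' = a * b / (1 - b * t)\<^sup>2 > (k t)\<^sup>2\<close>
  because \<open>b > a\<close>; this strictness is what the barrier argument needs.\<close>

lemma quad_gap_mat_nonneg_strict:
  assumes ab: "0 < a" "a < b" "b * T < 1" and \<kappa>: "\<kappa> < a"
    and init: "\<And>S x. S \<subseteq> G \<Longrightarrow> 0 < w S \<Longrightarrow> 0 \<le> quad G (gap_mat \<kappa> S 0) x"
  shows "S \<subseteq> G \<Longrightarrow> 0 < w S \<Longrightarrow> 0 \<le> t \<Longrightarrow> t \<le> T \<Longrightarrow> 0 \<le> quad G (gap_mat (a / (1 - b * t)) S t) x"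
proof (induction "card (G - S)" arbitrary: S t x rule: less_induct)
  case less
  define k where "k = (\<lambda>t. a / (1 - b * t))"
  \<comment> \<open>Over all of \<open>G\<close> the form is degenerate whenever a non-extension
    exists; on \<open>V\<close> the gradient is positive, so strict positivity is possible.\<close>
  define V where "V = {i \<in> G - S. 0 < w (insert i S)}"
  define y where "y = (\<lambda>i. if i \<in> V then x i else 0)"
  have finV: "finite V" "V \<subseteq> G" using finite_ground by (auto simp: V_def)
  have bt: "1 - b * s > 0" if "s \<le> T" for s
  proof -
    have "b * s \<le> b * T" using that ab by (intro mult_left_mono) auto
    thus ?thesis using ab by linarith
  qed
  have outside: "gap_mat k S t i j = 0" "gap_mat k S t j i = 0" if "i \<in> G - V" for i j k t
    using gap_mat_eq_0[of i S k t j] that by (auto simp: V_def)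
  have grad_pos: "grad S s i > 0" if "i \<in> V" "0 \<le> s" for i s
    using that partition_fun_pos[of "insert i S" s] by (auto simp: V_def grad_def)
  have diag_pos: "0 < (\<Sum>i\<in>G. grad S s i * (z i)\<^sup>2)" if z: "\<exists>i\<in>V. z i \<noteq> 0" "0 \<le> s" for s z
  proof -
    obtain i where "i \<in> V" "z i \<noteq> 0" using z by blast
    thus ?thesis
      using finV finite_ground grad_pos[of i s] \<open>0 \<le> s\<close>
      by (intro sum_pos2[of G i]) (auto intro: mult_nonneg_nonneg grad_nonneg)
  qed
  have restrict: "quad V (gap_mat k S t) z = quad G (gap_mat k S t) z" for k t z
    by (rule quad_gap_mat_restrict) (auto simp: V_def)
  have Z_pos: "partition_fun S s > 0" if "0 \<le> s" for s
    using partition_fun_pos[OF less.prems(2) that] .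
  have pos: "0 < quad V (gap_mat (k t) S t) x" if "\<exists>i\<in>V. x i \<noteq> 0"
  proof (rule quad_pos_barrier[where A = "\<lambda>t. gap_mat (k t) S t" and T = T])
    show "finite V" by (rule finV)
    show "gap_mat (k t) S t i j = gap_mat (k t) S t j i" for t i j by (rule gap_mat_sym)
    show "0 \<le> t" "t \<le> T" by fact+
    show "\<exists>i\<in>V. x i \<noteq> 0" by fact
    fix i j
    have "continuous_on {0..T} (partition_fun S)"
      by (rule DERIV_continuous_on[OF has_field_derivative_at_within[OF DERIV_partition_fun]])
    moreover have "continuous_on {0..T} (\<lambda>t. grad S t i)" for i
      by (rule DERIV_continuous_on[OF has_field_derivative_at_within[OF DERIV_grad]])
    moreover have "continuous_on {0..T} (\<lambda>t. hess S t i j)"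
      by (rule DERIV_continuous_on[OF has_field_derivative_at_within[OF DERIV_hess]])
    moreover have "continuous_on {0..T} k"
      unfolding k_def using bt by (intro continuous_intros) force
    moreover have "\<forall>t\<in>{0..T}. partition_fun S t \<noteq> 0"
      using Z_pos by force
    ultimately show "continuous_on {0..T} (\<lambda>t. gap_mat (k t) S t i j)"
      unfolding gap_mat_def diag_mat_def
      by (cases "i = j") (auto intro!: continuous_intros)
  next
    fix z :: "'a \<Rightarrow> real" assume z: "\<exists>i\<in>V. z i \<noteq> 0"
    have "0 \<le> quad G (gap_mat \<kappa> S 0) z"
      by (rule init) fact+
    \<comment> \<open>The gap between \<open>\<kappa>\<close> and \<open>a\<close> turns the weak
      inequality at time 0 into a strict one.\<close>
    moreover have "\<kappa> * (\<Sum>i\<in>G. grad S 0 i * (z i)\<^sup>2) < a * (\<Sum>i\<in>G. grad S 0 i * (z i)\<^sup>2)"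
      using \<kappa> diag_pos[OF z, of 0] by simp
    ultimately show "0 < quad V (gap_mat (k 0) S 0) z"
      unfolding restrict quad_gap_mat by (simp add: k_def)
  next
    fix s and z :: "'a \<Rightarrow> real"
    assume s: "0 < s" "s \<le> T" and z: "\<exists>i\<in>V. z i \<noteq> 0" "\<forall>i. i \<notin> V \<longrightarrow> z i = 0"
      and null: "\<forall>i\<in>V. (\<Sum>j\<in>V. gap_mat (k s) S s i j * z j) = 0"
    have null': "(\<Sum>j\<in>G. gap_mat (k s) S s i j * z j) = 0" if "i \<in> G" for i
    proof (cases "i \<in> V")
      case True
      have "(\<Sum>j\<in>G. gap_mat (k s) S s i j * z j) = (\<Sum>j\<in>V. gap_mat (k s) S s i j * z j)"
        using finV finite_ground z(2) by (intro sum.mono_neutral_right) auto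
      thus ?thesis using null True by simp
    next
      case False
      thus ?thesis using outside that by simp
    qed
    show "\<exists>d>0. ((\<lambda>s. quad V (gap_mat (k s) S s) z) has_real_derivative d) (at s)"
      unfolding restrict
    proof (rule quad_gap_mat_deriv_pos)
      show "0 < w S" "0 \<le> s" using less.prems s by auto
      show "(k has_real_derivative a * b / (1 - b * s)\<^sup>2) (at s)"
        unfolding k_def using bt[OF s(2)]
        by (auto intro!: derivative_eq_intros simp: power2_eq_square)
      show "(k s)\<^sup>2 < a * b / (1 - b * s)\<^sup>2"
        unfolding k_def power_divide using bt[OF s(2)] ab
        by (intro divide_strict_right_mono) (auto simp: power2_eq_square)
      show "0 < (\<Sum>i\<in>G. grad S s i * (z i)\<^sup>2)"
        using diag_pos z s by simp
      show "(\<Sum>j\<in>G. gap_mat (k s) S s i j * z j) = 0" if "i \<in> G" for i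
        by (rule null') fact
      fix m assume m: "m \<in> G - S" "0 < w (insert m S)"
      \<comment> \<open>The induction hypothesis is used at the same time \<open>s\<close> and with
        the same \<open>k\<close>, but for the larger conditioning set.\<close>
      have "card (G - insert m S) < card (G - S)"
        using m finite_ground by (intro psubset_card_mono) auto
      thus "0 \<le> quad G (gap_mat (k s) (insert m S) s) z"
        unfolding k_def using m s less.prems by (intro less.hyps) auto
    qed
  qed
  show ?case
  proof (cases "\<exists>i\<in>V. x i \<noteq> 0")
    case True
    thus ?thesis using pos unfolding restrict k_def by simp
  next
    case False
    hence "quad V (gap_mat (k t) S t) x = 0" by (simp add: quad_def)
    thus ?thesis unfolding restrict k_def by simp
  qed
qed

text \<open>Take \<open>a = \<kappa> + e\<close> and \<open>b = \<kappa> + 2 * e\<close> in the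
  strict version and let \<open>e\<close> tend to 0 from the right. This also covers
  \<open>\<kappa> = 0\<close>, where the strict version needs a positive \<open>a\<close>.\<close>

lemma quad_gap_mat_nonneg:
  assumes \<kappa>: "0 \<le> \<kappa>" "\<kappa> * t < 1"
    and init: "\<And>S x. S \<subseteq> G \<Longrightarrow> 0 < w S \<Longrightarrow> 0 \<le> quad G (gap_mat \<kappa> S 0) x"
    and S: "S \<subseteq> G" "0 < w S" and t: "0 \<le> t"
  shows "0 \<le> quad G (gap_mat (\<kappa> / (1 - \<kappa> * t)) S t) x"
proof (rule tendsto_lowerbound)
  show "((\<lambda>e. quad G (gap_mat ((\<kappa> + e) / (1 - (\<kappa> + 2 * e) * t)) S t) x)
      \<longlongrightarrow> quad G (gap_mat (\<kappa> / (1 - \<kappa> * t)) S t) x) (at_right 0)"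
    unfolding quad_gap_mat using \<kappa> by (auto intro!: tendsto_eq_intros)
  have "((\<lambda>e. (\<kappa> + 2 * e) * t) \<longlongrightarrow> \<kappa> * t) (at_right 0)"
    by (auto intro!: tendsto_eq_intros)
  hence "eventually (\<lambda>e. (\<kappa> + 2 * e) * t < 1) (at_right 0)"
    using \<kappa>(2) by (rule order_tendstoD)
  moreover have "eventually (\<lambda>e::real. e > 0) (at_right 0)"
    by (rule eventually_at_right_less)
  ultimately show "eventually (\<lambda>e. 0 \<le> quad G (gap_mat ((\<kappa> + e) / (1 - (\<kappa> + 2 * e) * t)) S t) x) (at_right 0)"
  proof eventually_elim
    case (elim e)
    show ?case
      by (rule quad_gap_mat_nonneg_strict[of _ _ t \<kappa>]) (use elim \<kappa> init S t in auto)
  qed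
qed simp

section \<open>Moments of the tilted weights\<close>

lemma weighted_first_moment:
  assumes "i \<in> G - S"
  shows "(\<Sum>T\<in>Pow (G - S). indicator T i * (w (S \<union> T) * t ^ card T)) = t * grad S t i"
proof -
  have fin: "finite (G - S)" using finite_ground by simp
  have "(\<Sum>T\<in>Pow (G - S). indicator T i * (w (S \<union> T) * t ^ card T)) =
      (\<Sum>T\<in>{T \<in> Pow (G - S). i \<in> T}. w (S \<union> T) * t ^ card T)"
    unfolding sum.inter_filter[OF finite_Pow_iff[THEN iffD2, OF fin]]
    by (intro sum.cong) auto
  also have "\<dots> = (\<Sum>T\<in>Pow (G - S - {i}). w (S \<union> insert i T) * t ^ card (insert i T))"
    by (rule sum_Pow_containing) fact
  also have "\<dots> = (\<Sum>T\<in>Pow (G - insert i S). t * (w (insert i S \<union> T) * t ^ card T))"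
  proof (rule sum.cong)
    show "Pow (G - S - {i}) = Pow (G - insert i S)" by blast
    fix T assume T: "T \<in> Pow (G - insert i S)"
    hence "finite T" "i \<notin> T" using finite_ground by (auto intro: finite_subset)
    thus "w (S \<union> insert i T) * t ^ card (insert i T) = t * (w (insert i S \<union> T) * t ^ card T)"
      by simp
  qed
  also have "\<dots> = t * grad S t i"
    using assms by (simp add: grad_def partition_fun_def sum_distrib_left)
  finally show ?thesis .
qed

text \<open>Deleting \<open>i\<close> and then \<open>j\<close> from the sets containing both costs
  a factor \<open>t\<close> each. The indices must differ, since the diagonal of \<open>hess\<close>
  is 0 while the diagonal second moment is the first moment.\<close>

lemma weighted_second_moment:
  assumes "i \<in> G - S" "j \<in> G - S" "i \<noteq> j"
  shows "(\<Sum>T\<in>Pow (G - S). indicator T i * indicator T j * (w (S \<union> T) * t ^ card T)) =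
    t\<^sup>2 * hess S t i j"
proof -
  have fin: "finite (G - S)" using finite_ground by simp
  have "(\<Sum>T\<in>Pow (G - S). indicator T i * indicator T j * (w (S \<union> T) * t ^ card T)) =
      (\<Sum>T\<in>{T \<in> Pow (G - S). i \<in> T}. indicator T j * (w (S \<union> T) * t ^ card T))"
    unfolding sum.inter_filter[OF finite_Pow_iff[THEN iffD2, OF fin]]
    by (intro sum.cong) auto
  also have "\<dots> = (\<Sum>T\<in>Pow (G - S - {i}). indicator (insert i T) j * (w (S \<union> insert i T) * t ^ card (insert i T)))"
    by (rule sum_Pow_containing) fact
  also have "\<dots> = (\<Sum>T\<in>Pow (G - insert i S). t * (indicator T j * (w (insert i S \<union> T) * t ^ card T)))"
  proof (rule sum.cong)
    show "Pow (G - S - {i}) = Pow (G - insert i S)" by blast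
    fix T assume T: "T \<in> Pow (G - insert i S)"
    hence "finite T" "i \<notin> T" using finite_ground by (auto intro: finite_subset)
    thus "indicator (insert i T) j * (w (S \<union> insert i T) * t ^ card (insert i T)) =
        t * (indicator T j * (w (insert i S \<union> T) * t ^ card T))"
      using assms(3) by (simp add: indicator_def)
  qed
  also have "\<dots> = t * (t * grad (insert i S) t j)"
    unfolding sum_distrib_left[symmetric] using assms by (subst weighted_first_moment) auto
  also have "\<dots> = t\<^sup>2 * hess S t i j"
    using assms by (simp add: hess_def power2_eq_square)
  finally show ?thesis .
qed

end

section \<open>Translation between the distributions and the weights\<close>

locale supported_family =
  fixes G :: "'a set" and X :: "'a set set" and \<mu> :: "'a set pmf"
  assumes finite_G: "finite G" and X_subset: "X \<subseteq> Pow G"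
    and downward: "downward_closed X" and support: "fully_supported_on \<mu> X"
begin

lemma pmf_pos_iff: "0 < pmf \<mu> S \<longleftrightarrow> S \<in> X"
  using support by (simp add: fully_supported_on_def)

sublocale downward_weight G "pmf \<mu>"
proof
  show "0 < pmf \<mu> S" if "S \<subseteq> T" "0 < pmf \<mu> T" for S T
    using that downward by (auto simp: pmf_pos_iff downward_closed_def)
qed (rule finite_G, simp)

lemma pmf_link:
  assumes "S \<in> X"
  obtains c where "c > 0"
    "\<And>T. pmf (link_pmf G X \<mu> S) T = (if T \<subseteq> G - S then c * pmf \<mu> (S \<union> T) else 0)"
proof
  let ?A = "{T. T \<subseteq> G - S \<and> S \<union> T \<in> X}"
  define c where "c = 1 / (\<Sum>T\<in>?A. pmf \<mu> (S \<union> T))"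
  have "finite ?A"
    by (rule finite_subset[of _ "Pow G"]) (use finite_G in auto)
  hence "0 < (\<Sum>T\<in>?A. pmf \<mu> (S \<union> T))"
    by (rule sum_pos2[of _ "{}"]) (use assms in \<open>auto simp: pmf_pos_iff\<close>)
  thus "c > 0" by (simp add: c_def)
  show "pmf (link_pmf G X \<mu> S) T = (if T \<subseteq> G - S then c * pmf \<mu> (S \<union> T) else 0)" for T
  proof (cases "S \<union> T \<in> X")
    case False
    hence "pmf \<mu> (S \<union> T) = 0" using pmf_pos_iff[of "S \<union> T"] pmf_nonneg[of \<mu> "S \<union> T"] by linarith
    thus ?thesis
      using pmf_link_pmf[OF finite_G X_subset support assms, of T] by simp
  qed (simp add: pmf_link_pmf[OF finite_G X_subset support assms] c_def)
qed

lemma pmf_tilt_link: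
  assumes "S \<in> X" "0 < l" "T \<subseteq> G - S"
  shows "pmf (tilt_pmf (G - S) l (link_pmf G X \<mu> S)) T =
    pmf \<mu> (S \<union> T) * l ^ card T / partition_fun S l"
proof -
  obtain c where c: "c > 0"
    "\<And>T. pmf (link_pmf G X \<mu> S) T = (if T \<subseteq> G - S then c * pmf \<mu> (S \<union> T) else 0)"
    using pmf_link[OF assms(1)] by blast
  have "set_pmf (link_pmf G X \<mu> S) \<subseteq> Pow (G - S)"
    by (auto simp: set_pmf_iff c(2) split: if_splits)
  from pmf_tilt_pmf[OF _ this assms(2), of T]
  have "pmf (tilt_pmf (G - S) l (link_pmf G X \<mu> S)) T =
      c * pmf \<mu> (S \<union> T) * l ^ card T / (\<Sum>T\<in>Pow (G - S). c * pmf \<mu> (S \<union> T) * l ^ card T)"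
    using finite_G assms(3) by (simp add: c(2))
  also have "(\<Sum>T\<in>Pow (G - S). c * pmf \<mu> (S \<union> T) * l ^ card T) = c * partition_fun S l"
    by (simp add: partition_fun_def sum_distrib_left mult_ac)
  finally show ?thesis using c(1) by simp
qed

text \<open>Conjugating the difference in the hypothesis by the diagonal matrix of ratios yields the
  gap matrix at time 0 divided by \<open>pmf \<mu> S\<close>. The identity matrix supplies the
  diagonal of the rank-one term, and the inverse ratios supply the diagonal term with factor
  \<open>\<kappa>\<close>.\<close>

lemma quad_gap_mat_0_nonneg:
  assumes S: "S \<in> X"
    and le: "loewner_le_on (extensions G X S) (corr_mat G X \<mu> S)
      (\<lambda>i j. diag_mat (\<lambda>_. 1) i j + \<kappa> * diag_mat (\<lambda>k. inverse (ratio_vec \<mu> S k)) i j)"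
  shows "0 \<le> quad G (gap_mat \<kappa> S 0) x"
proof -
  let ?V = "extensions G X S"
  let ?B = "\<lambda>i j. diag_mat (\<lambda>_. 1) i j + \<kappa> * diag_mat (\<lambda>k. inverse (ratio_vec \<mu> S k)) i j
    - corr_mat G X \<mu> S i j"
  define y where "y = (\<lambda>i. ratio_vec \<mu> S i * x i)"
  have w: "pmf \<mu> S > 0" using S by (simp add: pmf_pos_iff)
  obtain c where c: "c > 0"
    "\<And>T. pmf (link_pmf G X \<mu> S) T = (if T \<subseteq> G - S then c * pmf \<mu> (S \<union> T) else 0)"
    using pmf_link[OF S] by blast
  have entry: "y i * ?B i j * y j = 1 / pmf \<mu> S * (x i * gap_mat \<kappa> S 0 i j * x j)"
    if i: "i \<in> ?V" and j: "j \<in> ?V" for i j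
  proof -
    have ij: "i \<in> G" "i \<notin> S" "j \<in> G" "j \<notin> S" "pmf \<mu> (insert i S) > 0" "pmf \<mu> (insert j S) > 0"
      using i j by (auto simp: extensions_def pmf_pos_iff)
    show ?thesis
    proof (cases "i = j")
      case True
      thus ?thesis
        using w ij by (simp add: y_def gap_mat_def diag_mat_def corr_mat_def ratio_vec_def
            hess_def grad_def partition_fun_0 field_simps)
    next
      case False
      have corr: "corr_mat G X \<mu> S i j = pmf \<mu> (insert i (insert j S)) * pmf \<mu> S /
          (pmf \<mu> (insert i S) * pmf \<mu> (insert j S)) - 1"
        using False ij c(1) by (simp add: corr_mat_def c(2))
      show ?thesis
        unfolding corr using False w ij by (simp add: y_def gap_mat_def diag_mat_def ratio_vec_def
            hess_def grad_def partition_fun_0 insert_commute field_simps)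
    qed
  qed
  have "0 \<le> (\<Sum>i\<in>?V. \<Sum>j\<in>?V. y i * ?B i j * y j)"
    using le by (simp add: loewner_le_on_def psd_on_def)
  also have "\<dots> = 1 / pmf \<mu> S * quad ?V (gap_mat \<kappa> S 0) x"
    unfolding quad_def sum_distrib_left by (intro sum.cong refl entry)
  also have "quad ?V (gap_mat \<kappa> S 0) x = quad G (gap_mat \<kappa> S 0) x"
    by (rule quad_gap_mat_restrict) (auto simp: extensions_def pmf_pos_iff)
  finally show ?thesis using w by (simp add: zero_le_divide_iff)
qed

lemma expectation_tilt_link:
  assumes "S \<in> X" "0 < l"
  defines "\<nu> \<equiv> tilt_pmf (G - S) l (link_pmf G X \<mu> S)"
  shows "measure_pmf.expectation \<nu> f =
    (\<Sum>T\<in>Pow (G - S). f T * (pmf \<mu> (S \<union> T) * l ^ card T)) / partition_fun S l"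
    and "set_pmf \<nu> \<subseteq> Pow (G - S)"
proof -
  obtain c where "\<And>T. pmf (link_pmf G X \<mu> S) T = (if T \<subseteq> G - S then c * pmf \<mu> (S \<union> T) else 0)"
    using pmf_link[OF assms(1)] by blast
  hence "set_pmf (link_pmf G X \<mu> S) \<subseteq> Pow (G - S)"
    by (auto simp: set_pmf_iff split: if_splits)
  thus sub: "set_pmf \<nu> \<subseteq> Pow (G - S)"
    unfolding \<nu>_def using pmf_tilt_pmf[of "G - S" _ l] finite_G assms(2)
    by (auto simp: set_pmf_iff split: if_splits)
  have "measure_pmf.expectation \<nu> f = (\<Sum>T\<in>Pow (G - S). f T * pmf \<nu> T)"
    by (rule integral_measure_pmf_real) (use finite_G sub in auto)
  also have "\<dots> = (\<Sum>T\<in>Pow (G - S). f T * (pmf \<mu> (S \<union> T) * l ^ card T) / partition_fun S l)"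
    unfolding \<nu>_def by (intro sum.cong) (auto simp: pmf_tilt_link assms)
  finally show "measure_pmf.expectation \<nu> f =
      (\<Sum>T\<in>Pow (G - S). f T * (pmf \<mu> (S \<union> T) * l ^ card T)) / partition_fun S l"
    by (simp add: sum_divide_distrib)
qed

lemma mean_vec_tilt_link:
  assumes "S \<in> X" "0 < l" "i \<in> G - S"
  shows "mean_vec (tilt_pmf (G - S) l (link_pmf G X \<mu> S)) i = l * grad S l i / partition_fun S l"
  unfolding mean_vec_def expectation_tilt_link(1)[OF assms(1,2)] weighted_first_moment[OF assms(3)] ..

lemma cov_mat_tilt_link:
  assumes "S \<in> X" "0 < l" "i \<in> G - S" "j \<in> G - S"
  defines "\<nu> \<equiv> tilt_pmf (G - S) l (link_pmf G X \<mu> S)"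
  shows "cov_mat \<nu> i j = (if i = j then mean_vec \<nu> i else l\<^sup>2 * hess S l i j / partition_fun S l)
    - mean_vec \<nu> i * mean_vec \<nu> j"
proof -
  have "finite (set_pmf \<nu>)"
    using expectation_tilt_link(2)[OF assms(1,2)] finite_G unfolding \<nu>_def
    by (auto intro: finite_subset)
  hence int: "integrable (measure_pmf \<nu>) f" for f :: "'a set \<Rightarrow> real"
    by (rule integrable_measure_pmf_finite)
  have "cov_mat \<nu> i j = measure_pmf.expectation \<nu> (\<lambda>T. indicator T i * indicator T j
      - mean_vec \<nu> j * indicator T i - mean_vec \<nu> i * indicator T j + mean_vec \<nu> i * mean_vec \<nu> j)"
    unfolding cov_mat_def by (intro Bochner_Integration.integral_cong) (auto simp: algebra_simps)
  also have "\<dots> = measure_pmf.expectation \<nu> (\<lambda>T. indicator T i * indicator T j)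
      - mean_vec \<nu> i * mean_vec \<nu> j"
    by (simp add: int mean_vec_def)
  also have "measure_pmf.expectation \<nu> (\<lambda>T. indicator T i * indicator T j :: real) =
      (if i = j then mean_vec \<nu> i else l\<^sup>2 * hess S l i j / partition_fun S l)"
  proof (cases "i = j")
    case True
    have idem: "indicator T j * indicator T j = (indicator T j :: real)" for T
      by (simp add: indicator_def)
    show ?thesis unfolding True idem mean_vec_def by simp
  next
    case False
    thus ?thesis
      unfolding \<nu>_def expectation_tilt_link(1)[OF assms(1,2)]
        weighted_second_moment[OF assms(3,4) False] by simp
  qed
  finally show ?thesis .
qed

lemma cov_tilt_link_le:
  assumes \<kappa>: "0 \<le> \<kappa>" "\<kappa> * l < 1" and l: "0 < l" and S: "S \<in> X"
    and le: "\<And>S. S \<in> X \<Longrightarrow> \<not> maximal_in G X S \<Longrightarrow>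
      loewner_le_on (extensions G X S) (corr_mat G X \<mu> S)
        (\<lambda>i j. diag_mat (\<lambda>_. 1) i j + \<kappa> * diag_mat (\<lambda>k. inverse (ratio_vec \<mu> S k)) i j)"
  defines "\<nu> \<equiv> tilt_pmf (G - S) l (link_pmf G X \<mu> S)"
  shows "loewner_le_on (G - S) (cov_mat \<nu>) (\<lambda>i j. 1 / (1 - \<kappa> * l) * diag_mat (mean_vec \<nu>) i j)"
proof -
  define k where "k = \<kappa> / (1 - \<kappa> * l)"
  define Z where "Z = partition_fun S l"
  have Z: "Z > 0" unfolding Z_def using S l by (intro partition_fun_pos) (auto simp: pmf_pos_iff)
  have init: "0 \<le> quad G (gap_mat \<kappa> R 0) x" if "0 < pmf \<mu> R" for R x
  proof (rule quad_gap_mat_0_nonneg)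
    show "R \<in> X" using that by (simp add: pmf_pos_iff)
    show "loewner_le_on (extensions G X R) (corr_mat G X \<mu> R)
      (\<lambda>i j. diag_mat (\<lambda>_. 1) i j + \<kappa> * diag_mat (\<lambda>k. inverse (ratio_vec \<mu> R k)) i j)"
    \<comment> \<open>The induction over links also reaches maximal sets; there the index set is
      empty and the Loewner inequality is trivial.\<close>
    proof (cases "maximal_in G X R")
      case True
      thus ?thesis by (simp add: maximal_in_def loewner_le_on_def psd_on_def)
    qed (use le \<open>R \<in> X\<close> in auto)
  qed
  have main: "0 \<le> quad (G - S) (gap_mat k S l) x" for x
  proof -
    have "0 \<le> quad G (gap_mat k S l) x"
      unfolding k_def using \<kappa> l S X_subset init
      by (intro quad_gap_mat_nonneg) (auto simp: pmf_pos_iff)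
    also have "\<dots> = quad (G - S) (gap_mat k S l) x"
      by (rule quad_gap_mat_restrict[symmetric]) auto
    finally show ?thesis .
  qed
  have entry: "1 / (1 - \<kappa> * l) * diag_mat (mean_vec \<nu>) i j - cov_mat \<nu> i j =
      l\<^sup>2 / Z * gap_mat k S l i j" if ij: "i \<in> G - S" "j \<in> G - S" for i j
  proof -
    have mean: "mean_vec \<nu> i = l * grad S l i / Z" if "i \<in> G - S" for i
      unfolding \<nu>_def Z_def by (rule mean_vec_tilt_link[OF S l that])
    have cov: "cov_mat \<nu> i j = (if i = j then mean_vec \<nu> i else l\<^sup>2 * hess S l i j / Z)
        - mean_vec \<nu> i * mean_vec \<nu> j"
      unfolding \<nu>_def Z_def by (rule cov_mat_tilt_link[OF S l ij])
    \<comment> \<open>The summand 1 cancels the mean on the diagonal of the covariance, and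
      \<open>l * k\<close> leaves the diagonal term of the gap matrix.\<close>
    have "1 / (1 - \<kappa> * l) = 1 + l * k"
      using \<kappa>(2) by (simp add: k_def field_simps)
    moreover have "hess S l i j = 0" if "i = j"
      using that by (simp add: hess_def grad_def)
    ultimately show ?thesis
      using Z unfolding cov mean[OF ij(1)] mean[OF ij(2)] gap_mat_def diag_mat_def Z_def[symmetric]
      by (simp add: mean[OF ij(1)] field_simps power2_eq_square)
  qed
  show ?thesis
    unfolding loewner_le_on_def psd_on_def
  proof (intro conjI ballI allI)
    fix i j assume "i \<in> G - S" "j \<in> G - S"
    thus "1 / (1 - \<kappa> * l) * diag_mat (mean_vec \<nu>) i j - cov_mat \<nu> i j =
        1 / (1 - \<kappa> * l) * diag_mat (mean_vec \<nu>) j i - cov_mat \<nu> j i"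
      by (simp only: entry gap_mat_sym[of k S l i j])
  next
    fix x :: "'a \<Rightarrow> real"
    have "(\<Sum>i\<in>G - S. \<Sum>j\<in>G - S. x i * (1 / (1 - \<kappa> * l) * diag_mat (mean_vec \<nu>) i j - cov_mat \<nu> i j) * x j)
        = (\<Sum>i\<in>G - S. \<Sum>j\<in>G - S. x i * (l\<^sup>2 / Z * gap_mat k S l i j) * x j)"
      by (intro sum.cong refl) (simp only: entry)
    also have "\<dots> = l\<^sup>2 / Z * quad (G - S) (gap_mat k S l) x"
      by (simp add: quad_def sum_distrib_left mult_ac)
    also have "\<dots> \<ge> 0"
      using main Z by simp
    finally show "0 \<le> (\<Sum>i\<in>G - S. \<Sum>j\<in>G - S. x i *
        (1 / (1 - \<kappa> * l) * diag_mat (mean_vec \<nu>) i j - cov_mat \<nu> i j) * x j)" .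
  qed
qed

end

theorem theorem1p14:
  fixes n :: nat and X :: "nat set set" and \<mu> :: "nat set pmf" and \<delta> :: real
  assumes "X \<subseteq> Pow {1..n}" and "X \<noteq> {}" and "downward_closed X"
    and "fully_supported_on \<mu> X"
    and "0 \<le> \<delta>" and "\<delta> \<le> 1"
    and "\<And>S. S \<in> X \<Longrightarrow> \<not> maximal_in {1..n} X S \<Longrightarrow>
      loewner_le_on (extensions {1..n} X S) (corr_mat {1..n} X \<mu> S)
        (\<lambda>i j. diag_mat (\<lambda>_. 1) i j
              + (1 - \<delta>) * diag_mat (\<lambda>k. inverse (ratio_vec \<mu> S k)) i j)"
  shows "\<forall>S\<in>X. \<not> maximal_in {1..n} X S \<longrightarrow> (\<forall>\<theta>::real. 0 < \<theta> \<and> \<theta> < 1 \<longrightarrow>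
      (let U = {1..n} - S; \<nu> = tilt_pmf U (1 - \<theta>) (link_pmf {1..n} X \<mu> S) in
        loewner_le_on U (cov_mat \<nu>)
          (\<lambda>i j. 1 / (1 - (1 - \<delta>) * (1 - \<theta>)) * diag_mat (mean_vec \<nu>) i j)))"
proof (intro ballI impI allI)
  interpret supported_family "{1..n}" X \<mu>
    by unfold_locales (use assms in auto)
  fix S and \<theta> :: real assume S: "S \<in> X" and "0 < \<theta> \<and> \<theta> < 1"
  hence \<theta>: "0 < \<theta>" "\<theta> < 1" by auto
  \<comment> \<open>Positivity of \<open>\<theta>\<close> keeps the evaluation time before the pole
    of the comparison function, even for \<open>\<delta> = 0\<close>.\<close>
  have "(1 - \<delta>) * (1 - \<theta>) \<le> 1 * (1 - \<theta>)"
    using assms(5) \<theta> by (intro mult_right_mono) auto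
  also have "\<dots> < 1" using \<theta> by simp
  finally have "(1 - \<delta>) * (1 - \<theta>) < 1" .
  thus "let U = {1..n} - S; \<nu> = tilt_pmf U (1 - \<theta>) (link_pmf {1..n} X \<mu> S) in
        loewner_le_on U (cov_mat \<nu>)
          (\<lambda>i j. 1 / (1 - (1 - \<delta>) * (1 - \<theta>)) * diag_mat (mean_vec \<nu>) i j)"
    unfolding Let_def using assms(6,7) \<theta> S by (intro cov_tilt_link_le) auto
qed

end
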